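(* Let $(V,\mathcal I,\mathcal D,f)$ be a weighted configuration with $V\neq\emptyset$, and for $x\in\mathcal I$ let $H(x)(t)=\sum_{y\in\mathcal I,\ x\subseteq y}(-1)^{|y|-|x|}t^{|y|}f(y)$. Then the real $$t_0=\min\{t\geq 0 : \exists x\in\mathcal I,\ H(x)(t)=0\}$$ exists and is positive, and the set of reals $t\geq0$ for which $(V,\mathcal I,\mathcal D,f,t)$ is a probabilistic configuration is exactly $[0,t_0]$. Furthermore, the rest $R(t)=H(\emptyset)(t)$ is decreasing on $[0,t_0]$; hence $t_0$ minimizes the rest among all $t$ making $(V,\mathcal I,\mathcal D,f,t)$ probabilistic.
   Context: A configuration is a triple $(V,\mathcal I,\mathcal D)$ with $V$ finite, $\mathcal I\subseteq\mathcal P(V)$ non empty, downward closed under inclusion, containing all singletons, and $\mathcal D=\mathcal P(V)\setminus\mathcal I$. For $x,y\in\mathcal I$, $x\parallel y$ means $x\cap y=\emptyset$ and $x\cup y\in\mathcal I$. A valuation is $f:\mathcal I\to\mathbb R_{>0}$ with $f(\emptyset)=1$ and $f(x\cup y)=f(x)f(y)$ whenever $x\parallel y$; write $f(a)=f(\{a\})$. A weighted configuration is $(V,\mathcal I,\mathcal D,f)$. For $t\ge0$, $(V,\mathcal I,\mathcal D,f,t)$ is a probabilistic configuration if there are a probability space $(\Omega,\mathcal F,\mathbb P)$ and $\psi:V\to\mathcal F$ with $\mathbb P(\psi(a))=tf(a)$ for all $a$, $(\psi(a))_{a\in x}$ mutually independent for every $x\in\mathcal I$, and $\mathbb P(\bigcap_{a\in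 x}\psi(a))=0$ for every $x\in\mathcal D$; its rest is $1-\mathbb P(\bigcup_{a\in V}\psi(a))$, which equals $H(\emptyset)(t)$ for every such space.
   Formalization: The minimum defining t_0 is taken over t>0 instead of t≥0, because H(x)(0)=0 for every non-empty x in I, so the minimum over t≥0 would always be 0, contradicting the claimed positivity. *)

theory Defs
  imports "HOL-Probability.Probability"
begin

locale configuration =
  fixes V :: "'a set" and I D :: "'a set set"
  assumes finite_V: "finite V"
    and I_subset: "I \<subseteq> Pow V"
    and I_nonempty: "I \<noteq> {}"
    and I_down_closed: "\<And>x y. x \<in> I \<Longrightarrow> y \<subseteq> x \<Longrightarrow> y \<in> I"
    and I_singletons: "\<And>a. a \<in> V \<Longrightarrow> {a} \<in> I"
    and D_eq: "D = Pow V - I"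

definition parallel :: "'a set set \<Rightarrow> 'a set \<Rightarrow> 'a set \<Rightarrow> bool" where
  "parallel I x y \<longleftrightarrow> x \<in> I \<and> y \<in> I \<and> x \<inter> y = {} \<and> x \<union> y \<in> I"

text \<open>A valuation is only meaningful on \<open>I\<close>; its values outside \<open>I\<close> are unconstrained and are
  never used below.\<close>

locale weighted_configuration = configuration V I D
  for V :: "'a set" and I D :: "'a set set" +
  fixes f :: "'a set \<Rightarrow> real"
  assumes f_pos: "\<And>x. x \<in> I \<Longrightarrow> f x > 0"
    and f_empty: "f {} = 1"
    and f_mult: "\<And>x y. parallel I x y \<Longrightarrow> f (x \<union> y) = f x * f y"

text \<open>Every summand of \<open>H I f x t\<close> carries \<open>t ^ card y\<close> with \<open>x \<subseteq> y\<close>, so \<open>H I f x\<close> vanishes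
  at \<open>0\<close> for every non-empty \<open>x\<close>. The smallest root is therefore only meaningful among \<open>t > 0\<close>.\<close>

definition H :: "'a set set \<Rightarrow> ('a set \<Rightarrow> real) \<Rightarrow> 'a set \<Rightarrow> real \<Rightarrow> real" where
  "H I f x t = (\<Sum>y\<in>{y \<in> I. x \<subseteq> y}. (-1) ^ (card y - card x) * t ^ card y * f y)"

definition realizes ::
  "'a set \<Rightarrow> 'a set set \<Rightarrow> 'a set set \<Rightarrow> ('a set \<Rightarrow> real) \<Rightarrow> real \<Rightarrow> 'w measure \<Rightarrow> ('a \<Rightarrow> 'w set) \<Rightarrow> bool"
where
  "realizes V I D f t M \<psi> \<longleftrightarrow>
     prob_space M \<and>
     (\<forall>a\<in>V. \<psi> a \<in> sets M) \<and>
     (\<forall>a\<in>V. measure M (\<psi> a) = t * f {a}) \<and>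
     (\<forall>x\<in>I. prob_space.indep_events M \<psi> x) \<and>
     (\<forall>x\<in>D. measure M (\<Inter>a\<in>x. \<psi> a) = 0)"

text \<open>HOL cannot quantify existentially over types inside a formula, so the type \<open>'w\<close> of sample
  points is an explicit parameter. The sample space itself is an arbitrary set of such points,
  with an arbitrary sigma-algebra.\<close>

definition probabilistic_configuration ::
  "'w itself \<Rightarrow> 'a set \<Rightarrow> 'a set set \<Rightarrow> 'a set set \<Rightarrow> ('a set \<Rightarrow> real) \<Rightarrow> real \<Rightarrow> bool"
where
  "probabilistic_configuration _ V I D f t \<longleftrightarrow>
     t \<ge> 0 \<and> (\<exists>(M :: 'w measure) \<psi>. realizes V I D f t M \<psi>)"

definition rest :: "'a set \<Rightarrow> 'w measure \<Rightarrow> ('a \<Rightarrow> 'w set) \<Rightarrow> real" where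
  "rest V M \<psi> = 1 - measure M (\<Union>a\<in>V. \<psi> a)"

end

theory Submission
  imports Defs
begin

text \<open>Moebius inversion shows that \<open>H(x)(t)\<close> must be the probability that exactly the events of
  \<open>x\<close> occur, so that \<open>t\<close> is admissible iff all \<open>H(x)(t)\<close> are non-negative; the witness lives on
  \<open>I\<close> itself with the masses \<open>H(x)(t)\<close>. The weighted superset sums
  \<open>(K\<^sub>v g)(x) = (\<Sum>y \<supseteq> x. v\<^sup>|\<^sup>y\<^sup>|\<^sup>-\<^sup>|\<^sup>x\<^sup>| g y)\<close> satisfy \<open>K\<^sub>v K\<^sub>w = K\<^bsub>v+w\<^esub>\<close>, which contains
  both the inversion and the thinning identity expressing \<open>H(x)(u t)\<close>, for \<open>0 \<le> u \<le> 1\<close>, as a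
  non-negative combination of the \<open>H(y)(t)\<close> with \<open>x \<subseteq> y\<close>. Hence the admissible parameters form
  an initial interval; it is closed by continuity and bounded since probabilities are at most 1.
  Below its maximum all \<open>H(x)\<close> are strictly positive, and at the maximum one of them vanishes.\<close>

section \<open>Weighted superset sums and their composition\<close>

text \<open>Writing \<open>y = x \<union> u\<close> with \<open>u \<subseteq> z - x\<close> turns
  the sum into the expansion of a product of equal factors \<open>v + w\<close> over
  \<open>z - x\<close>: the binomial theorem, indexed by subsets.\<close>

lemma sum_interval_power:
  fixes v w :: "'b::comm_semiring_1"
  assumes "finite z" "x \<subseteq> z"
  shows "(\<Sum>y | x \<subseteq> y \<and> y \<subseteq> z. v ^ (card y - card x) * w ^ (card z - card y)) =
    (v + w) ^ (card z - card x)"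
proof -
  have "(v + w) ^ (card z - card x) = (\<Prod>a\<in>z - x. v + w)"
    using assms by (simp add: card_Diff_subset finite_subset)
  also have "\<dots> = (\<Sum>u\<in>Pow (z - x). v ^ card u * w ^ card ((z - x) - u))"
    using assms by (subst prod_add) auto
  also have "\<dots> = (\<Sum>y | x \<subseteq> y \<and> y \<subseteq> z. v ^ (card y - card x) * w ^ (card z - card y))"
  proof (rule sum.reindex_bij_witness[of _ "\<lambda>y. y - x" "\<lambda>u. x \<union> u"])
    fix u assume u: "u \<in> Pow (z - x)"
    then have fin: "finite x" "finite u" using assms by (auto intro: finite_subset)
    have "x \<inter> u = {}" using u by auto
    then have c: "card (x \<union> u) = card x + card u" using fin by (simp add: card_Un_disjoint)
    have "(z - x) - u = z - (x \<union> u)" by auto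
    moreover have "x \<union> u \<subseteq> z" using u assms by auto
    ultimately have "card ((z - x) - u) = card z - card (x \<union> u)"
      using fin by (simp add: card_Diff_subset)
    then show "v ^ (card (x \<union> u) - card x) * w ^ (card z - card (x \<union> u)) =
        v ^ card u * w ^ card ((z - x) - u)"
      using c by simp
  qed (use assms in auto)
  finally show ?thesis by simp
qed

text \<open>For \<open>v = 1\<close> this is the zeta transform of \<open>I\<close> under inclusion,
  for \<open>v = -1\<close> its Moebius inverse; other values of \<open>v\<close> serve for
  thinning.\<close>

definition superset_sum ::
  "'a set set \<Rightarrow> real \<Rightarrow> ('a set \<Rightarrow> real) \<Rightarrow> 'a set \<Rightarrow> real" where
  "superset_sum I v g x = (\<Sum>y | y \<in> I \<and> x \<subseteq> y. v ^ (card y - card x) * g y)"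

lemma superset_sum_cong:
  assumes "\<And>y. y \<in> I \<Longrightarrow> g y = h y"
  shows "superset_sum I v g x = superset_sum I v h x"
  unfolding superset_sum_def using assms by (intro sum.cong) auto

context configuration
begin

lemma finite_I: "finite I"
  using finite_subset[OF I_subset] finite_V by simp

lemma finite_mem_I: "x \<in> I \<Longrightarrow> finite x"
  using I_subset by (auto intro: finite_subset[OF _ finite_V])

lemma empty_in_I: "{} \<in> I"
  using I_nonempty I_down_closed by blast

lemma superset_sum_0:
  assumes "x \<in> I"
  shows "superset_sum I 0 g x = g x"
proof -
  \<comment> \<open>Since \<open>0 ^ 0 = 1\<close>, exactly the summand \<open>y = x\<close>
    survives.\<close>
  have "superset_sum I 0 g x = (\<Sum>y | y \<in> I \<and> x \<subseteq> y. if y = x then g x else 0)"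
    unfolding superset_sum_def
  proof (intro sum.cong)
    fix y assume y: "y \<in> {y \<in> I. x \<subseteq> y}"
    show "0 ^ (card y - card x) * g y = (if y = x then g x else 0)"
    proof (cases "y = x")
      case False
      then have "card x < card y" using y finite_mem_I by (auto intro: psubset_card_mono)
      then show ?thesis using False by simp
    qed simp
  qed simp
  also have "\<dots> = g x" using assms finite_I by (simp add: sum.delta)
  finally show ?thesis .
qed

text \<open>After exchanging the sums, the coefficient of \<open>g z\<close> is a sum over the
  interval from \<open>x\<close> to \<open>z\<close>. Downward closure puts this whole interval into
  \<open>I\<close>, so \<open>sum_interval_power\<close> evaluates it.\<close>

lemma superset_sum_superset_sum:
  "superset_sum I v (superset_sum I w g) x = superset_sum I (v + w) g x"
proof -
  let ?c = "\<lambda>y z. v ^ (card y - card x) * w ^ (card z - card y)"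
  have "superset_sum I v (superset_sum I w g) x =
      (\<Sum>y\<in>{y \<in> I. x \<subseteq> y}. \<Sum>z | z \<in> I \<and> y \<subseteq> z. ?c y z * g z)"
    by (simp add: superset_sum_def sum_distrib_left mult.assoc)
  also have "\<dots> = (\<Sum>z\<in>I. \<Sum>y | y \<in> {y \<in> I. x \<subseteq> y} \<and> y \<subseteq> z. ?c y z * g z)"
    using finite_I by (intro sum.swap_restrict) auto
  also have "\<dots> = (\<Sum>z\<in>I. \<Sum>y | x \<subseteq> y \<and> y \<subseteq> z. ?c y z * g z)"
    using I_down_closed by (intro sum.cong) auto
  also have "\<dots> = (\<Sum>z | z \<in> I \<and> x \<subseteq> z. \<Sum>y | x \<subseteq> y \<and> y \<subseteq> z. ?c y z * g z)"
    using finite_I by (intro sum.mono_neutral_right) (auto intro!: sum.neutral)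
  also have "\<dots> = superset_sum I (v + w) g x"
    unfolding superset_sum_def
    by (intro sum.cong) (auto simp: sum_distrib_right[symmetric] sum_interval_power finite_mem_I)
  finally show ?thesis .
qed

end

section \<open>Moebius inversion and thinning for \<open>H\<close>\<close>

context weighted_configuration
begin

lemma f_eq_prod:
  assumes "x \<in> I"
  shows "f x = (\<Prod>a\<in>x. f {a})"
proof -
  have "finite x" using assms by (rule finite_mem_I)
  then show ?thesis using assms
  proof (induction x rule: finite_induct)
    case empty
    show ?case by (simp add: f_empty)
  next
    case (insert a x)
    have "x \<in> I" "{a} \<in> I"
      by (auto intro: I_down_closed[OF insert.prems])
    then have "parallel I {a} x" using insert.hyps insert.prems by (simp add: parallel_def)
    from f_mult[OF this] show ?case using insert.hyps insert.IH[OF \<open>x \<in> I\<close>] by simp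
  qed
qed

lemma prod_scaled_f: "x \<in> I \<Longrightarrow> (\<Prod>a\<in>x. t * f {a}) = t ^ card x * f x"
  by (simp add: f_eq_prod[of x] prod.distrib)

lemma H_eq_superset_sum: "H I f x t = superset_sum I (-1) (\<lambda>y. t ^ card y * f y) x"
  by (simp add: H_def superset_sum_def mult.assoc)

text \<open>\<open>H\<close> is a Moebius transform, and summing over supersets undoes it because
  \<open>1 + (-1) = 0\<close>.\<close>

lemma sum_H:
  assumes "x \<in> I"
  shows "(\<Sum>y | y \<in> I \<and> x \<subseteq> y. H I f y t) = t ^ card x * f x"
proof -
  have "(\<Sum>y | y \<in> I \<and> x \<subseteq> y. H I f y t) = superset_sum I 1 (\<lambda>y. H I f y t) x"
    by (simp add: superset_sum_def)
  then show ?thesis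
    using assms by (simp add: H_eq_superset_sum superset_sum_superset_sum superset_sum_0)
qed

lemma sum_H_I: "(\<Sum>y\<in>I. H I f y t) = 1"
  using sum_H[OF empty_in_I] by (simp add: f_empty)

text \<open>For \<open>0 \<le> u \<le> 1\<close>, think of keeping each occurring event
  independently with probability \<open>u\<close>: exactly \<open>x\<close> remains if some
  \<open>y \<supseteq> x\<close> occurred, all of \<open>x\<close> was kept and all of
  \<open>y - x\<close> was dropped. The algebra behind it is
  \<open>- u = (1 - u) + (-1)\<close>.\<close>

lemma H_thinning:
  assumes "x \<in> I"
  shows "H I f x (u * t) =
    u ^ card x * (\<Sum>y | y \<in> I \<and> x \<subseteq> y. (1 - u) ^ (card y - card x) * H I f y t)"
proof -
  have "H I f x (u * t) = u ^ card x * superset_sum I (- u) (\<lambda>y. t ^ card y * f y) x"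
    unfolding H_eq_superset_sum superset_sum_def sum_distrib_left
  proof (intro sum.cong refl)
    fix y assume y: "y \<in> {y \<in> I. x \<subseteq> y}"
    then have "card x \<le> card y" using finite_mem_I by (auto intro: card_mono)
    then have "u ^ card y = u ^ card x * u ^ (card y - card x)"
      by (simp flip: power_add)
    then show "(-1) ^ (card y - card x) * ((u * t) ^ card y * f y) =
        u ^ card x * ((- u) ^ (card y - card x) * (t ^ card y * f y))"
      by (simp add: power_mult_distrib power_minus[of u])
  qed
  also have "superset_sum I (- u) (\<lambda>y. t ^ card y * f y) x =
      superset_sum I (1 - u) (\<lambda>y. H I f y t) x"
    by (simp add: H_eq_superset_sum superset_sum_superset_sum)
  finally show ?thesis by (simp add: superset_sum_def)
qed

lemma exists_H_pos:
  assumes "x \<in> I" "t > 0"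
  shows "\<exists>y\<in>I. x \<subseteq> y \<and> H I f y t > 0"
proof (rule ccontr)
  assume "\<not> ?thesis"
  then have "(\<Sum>y | y \<in> I \<and> x \<subseteq> y. H I f y t) \<le> 0"
    by (intro sum_nonpos) auto
  moreover have "t ^ card x * f x > 0" using assms f_pos by simp
  ultimately show False using sum_H[OF assms(1)] by simp
qed

text \<open>For \<open>u = s / t\<close> strictly between 0 and 1 all thinning weights are positive,
  so a single positive mass at \<open>t\<close> above \<open>x\<close> is enough.\<close>

lemma H_pos_below:
  assumes nonneg: "\<forall>y\<in>I. H I f y t \<ge> 0" and "0 < s" "s < t" "x \<in> I"
  shows "H I f x s > 0"
proof -
  define u where "u = s / t"
  have u: "0 < u" "u < 1" "s = u * t" using assms by (auto simp: u_def)
  obtain y where y: "y \<in> I" "x \<subseteq> y" "H I f y t > 0"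
    using exists_H_pos[of x t] assms by auto
  have "(\<Sum>y | y \<in> I \<and> x \<subseteq> y. (1 - u) ^ (card y - card x) * H I f y t) > 0"
    by (rule sum_pos2[of _ y]) (use finite_I y u nonneg in auto)
  then show ?thesis using u by (simp add: H_thinning[OF \<open>x \<in> I\<close>])
qed

lemma H_empty_less:
  assumes nonneg: "\<forall>y\<in>I. H I f y t \<ge> 0" and "0 \<le> s" "s < t" "V \<noteq> {}"
  shows "H I f {} t < H I f {} s"
proof -
  define u where "u = s / t"
  have u: "0 \<le> u" "u < 1" "s = u * t" using assms by (auto simp: u_def)
  obtain a where "a \<in> V" using assms by auto
  then obtain y where y: "y \<in> I" "a \<in> y" "H I f y t > 0"
    using exists_H_pos[of "{a}" t] I_singletons assms by auto
  have "H I f {} s = (\<Sum>y\<in>I. (1 - u) ^ card y * H I f y t)"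
    using H_thinning[OF empty_in_I, of u t] u by simp
  \<comment> \<open>The summand of \<open>{}\<close> has weight 1; the others are the gain from
    nonempty sets thinned to nothing, and the \<open>y\<close> containing \<open>a\<close> makes
    this gain strict.\<close>
  moreover have "\<dots> = H I f {} t + (\<Sum>y\<in>I - {{}}. (1 - u) ^ card y * H I f y t)"
    using finite_I empty_in_I by (subst sum.remove[of _ "{}"]) auto
  moreover have "(\<Sum>y\<in>I - {{}}. (1 - u) ^ card y * H I f y t) > 0"
    by (rule sum_pos2[of _ y]) (use finite_I y u nonneg in auto)
  ultimately show ?thesis by simp
qed

section \<open>Continuity and the sign near zero\<close>

lemma continuous_on_H: "continuous_on S (H I f x)"
  unfolding H_def by (intro continuous_intros)

text \<open>\<open>H I f x\<close> divided by \<open>t ^ card x\<close> tends to \<open>f x\<close> as \<open>t\<close> tends to \<open>0\<close>.\<close>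

lemma eventually_H_pos:
  assumes "x \<in> I"
  shows "eventually (\<lambda>t. H I f x t > 0) (at_right 0)"
proof -
  define G where "G = (\<lambda>t. superset_sum I (- t) f x)"
  have HG: "H I f x t = t ^ card x * G t" for t
    unfolding H_eq_superset_sum G_def superset_sum_def sum_distrib_left
  proof (intro sum.cong refl)
    fix y assume y: "y \<in> {y \<in> I. x \<subseteq> y}"
    then have "card x \<le> card y" using finite_mem_I by (auto intro: card_mono)
    then have "t ^ card y = t ^ card x * t ^ (card y - card x)"
      by (simp flip: power_add)
    then show "(-1) ^ (card y - card x) * (t ^ card y * f y) =
        t ^ card x * ((- t) ^ (card y - card x) * f y)"
      by (simp add: power_minus[of t])
  qed
  have "isCont G 0" unfolding G_def superset_sum_def by (intro continuous_intros)
  then have "(G \<longlongrightarrow> G 0) (at_right 0)"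
    by (simp add: isCont_def filterlim_at_split)
  moreover have "G 0 > 0" using assms f_pos by (simp add: G_def superset_sum_0)
  ultimately have "eventually (\<lambda>t. G t > 0) (at_right 0)" by (rule order_tendstoD)
  with eventually_at_right_less[of "0::real"] show ?thesis
    by eventually_elim (simp add: HG)
qed

section \<open>Every realization has the masses \<open>H\<close>\<close>

text \<open>The cells on which exactly the events of a given set occur partition the sample space.
  Their superset sums are the joint probabilities \<open>t ^ card x * f x\<close>, and Moebius
  inversion recovers the cells from these.\<close>

lemma realizes_exactly:
  fixes M :: "'w measure"
  assumes real: "realizes V I D f t M \<psi>" and "x \<in> I"
  shows "measure M {\<omega> \<in> space M. {a \<in> V. \<omega> \<in> \<psi> a} = x} = H I f x t"
proof -
  interpret prob_space M using real by (simp add: realizes_def)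
  have \<psi>[measurable]: "\<And>a. a \<in> V \<Longrightarrow> \<psi> a \<in> events" using real by (simp add: realizes_def)
  define E where "E x = {\<omega> \<in> space M. {a \<in> V. \<omega> \<in> \<psi> a} = x}" for x
  have E_events: "E x \<in> events" if "x \<subseteq> V" for x
  proof -
    have "E x = {\<omega> \<in> space M. \<forall>a\<in>V. \<omega> \<in> \<psi> a \<longleftrightarrow> a \<in> x}"
      using that by (auto simp: E_def)
    also have "\<dots> \<in> events"
      using finite_V by measurable
    finally show ?thesis .
  qed
  have sum_E: "(\<Sum>y | y \<in> Pow V \<and> x \<subseteq> y. prob (E y)) = prob {\<omega> \<in> space M. \<forall>a\<in>x. \<omega> \<in> \<psi> a}"
    if "x \<subseteq> V" for x
  proof -
    have "(\<Sum>y | y \<in> Pow V \<and> x \<subseteq> y. prob (E y)) = prob (\<Union>y\<in>{y \<in> Pow V. x \<subseteq> y}. E y)"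
      using finite_V E_events
      by (intro finite_measure_finite_Union[symmetric]) (auto simp: disjoint_family_on_def E_def)
    also have "(\<Union>y\<in>{y \<in> Pow V. x \<subseteq> y}. E y) = {\<omega> \<in> space M. \<forall>a\<in>x. \<omega> \<in> \<psi> a}"
      using that by (auto simp: E_def)
    finally show ?thesis .
  qed
  have all_Inter: "{\<omega> \<in> space M. \<forall>a\<in>x. \<omega> \<in> \<psi> a} = (\<Inter>a\<in>x. \<psi> a)"
    if "x \<subseteq> V" "x \<noteq> {}" for x
    using that sets.sets_into_space[OF \<psi>] by blast
  \<comment> \<open>The cell of \<open>y\<close> lies in the intersection of its events, which is
    null for \<open>y \<in> D\<close>. Sums over \<open>Pow V\<close> may therefore be restricted to
    \<open>I\<close>.\<close>
  have E_D: "prob (E y) = 0" if "y \<in> D" for y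
  proof -
    have y: "y \<subseteq> V" "y \<noteq> {}" using that D_eq empty_in_I by auto
    have "prob (E y) \<le> (\<Sum>z | z \<in> Pow V \<and> y \<subseteq> z. prob (E z))"
      using finite_V y by (intro member_le_sum) auto
    also have "\<dots> = 0"
      using sum_E[OF y(1)] all_Inter[OF y] that real by (simp add: realizes_def)
    finally show ?thesis by (simp add: measure_le_0_iff)
  qed
  have up: "superset_sum I 1 (\<lambda>y. prob (E y)) x = t ^ card x * f x" if "x \<in> I" for x
  proof -
    have x: "x \<subseteq> V" "finite x" using that I_subset finite_mem_I by auto
    have "superset_sum I 1 (\<lambda>y. prob (E y)) x = (\<Sum>y | y \<in> Pow V \<and> x \<subseteq> y. prob (E y))"
      unfolding superset_sum_def using finite_V I_subset E_D D_eq
      by (simp, intro sum.mono_neutral_left) auto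
    also have "\<dots> = prob {\<omega> \<in> space M. \<forall>a\<in>x. \<omega> \<in> \<psi> a}"
      by (rule sum_E) fact
    also have "\<dots> = t ^ card x * f x"
    \<comment> \<open>The empty index set needs its own case: its intersection is the whole type
      instead of \<open>space M\<close>.\<close>
    proof (cases "x = {}")
      case True
      then show ?thesis by (simp add: f_empty prob_space)
    next
      case False
      have "indep_events \<psi> x" using real that by (simp add: realizes_def)
      then have "prob (\<Inter>a\<in>x. \<psi> a) = (\<Prod>a\<in>x. prob (\<psi> a))"
        using False x by (simp add: indep_events_def)
      also have "\<dots> = (\<Prod>a\<in>x. t * f {a})"
        using real x by (intro prod.cong) (auto simp: realizes_def)
      finally show ?thesis using that x False by (simp add: all_Inter prod_scaled_f)
    qed
    finally show ?thesis .
  qed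
  have "H I f x t = superset_sum I (-1) (superset_sum I 1 (\<lambda>y. prob (E y))) x"
    unfolding H_eq_superset_sum by (intro superset_sum_cong) (simp add: up)
  also have "\<dots> = prob (E x)"
    using \<open>x \<in> I\<close> by (simp add: superset_sum_superset_sum superset_sum_0)
  finally show ?thesis by (simp add: E_def)
qed

lemma realizes_H_nonneg:
  assumes "realizes V I D f t M \<psi>" "x \<in> I"
  shows "H I f x t \<ge> 0"
  by (subst realizes_exactly[OF assms, symmetric]) (rule measure_nonneg)

lemma realizes_rest:
  assumes "realizes V I D f t M \<psi>"
  shows "rest V M \<psi> = H I f {} t"
proof -
  interpret prob_space M using assms by (simp add: realizes_def)
  have "(\<Union>a\<in>V. \<psi> a) \<in> events"
    using assms finite_V by (intro sets.finite_UN) (auto simp: realizes_def)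
  then have "rest V M \<psi> = prob (space M - (\<Union>a\<in>V. \<psi> a))"
    by (simp add: rest_def prob_compl)
  also have "space M - (\<Union>a\<in>V. \<psi> a) = {\<omega> \<in> space M. {a \<in> V. \<omega> \<in> \<psi> a} = {}}"
    by auto
  finally show ?thesis using realizes_exactly[OF assms empty_in_I] by simp
qed

section \<open>A realization on \<open>I\<close>\<close>

text \<open>A sample point is the set of events that occur at it. \<open>sum_H\<close> then gives
  the total mass 1 and the product formula on nonempty members of \<open>I\<close>; downward closure
  extends this to all subfamilies, as independence demands.\<close>

lemma realizes_point_measure:
  assumes nonneg: "\<forall>x\<in>I. H I f x t \<ge> 0"
  shows "realizes V I D f t (point_measure I (\<lambda>x. ennreal (H I f x t))) (\<lambda>a. {x \<in> I. a \<in> x})"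
proof -
  define M where "M = point_measure I (\<lambda>x. ennreal (H I f x t))"
  have meas: "measure M A = (\<Sum>x\<in>A. H I f x t)" if "A \<subseteq> I" for A
    using that finite_I nonneg by (simp add: M_def measure_point_measure_finite_if)
  have "emeasure M (space M) = 1"
    using finite_I nonneg
    by (simp add: M_def space_point_measure emeasure_point_measure_finite sum_ennreal sum_H_I)
  then interpret prob_space M by (rule prob_spaceI)
  have Inter: "(\<Inter>a\<in>x. {y \<in> I. a \<in> y}) = {y \<in> I. x \<subseteq> y}" if "x \<noteq> {}" for x :: "'a set"
    using that by auto
  have prob_Inter: "prob (\<Inter>a\<in>x. {y \<in> I. a \<in> y}) = t ^ card x * f x"
    if "x \<in> I" "x \<noteq> {}" for x
    using that by (simp add: Inter meas sum_H)
  have prob_event: "prob {x \<in> I. a \<in> x} = t * f {a}" if "a \<in> V" for a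
    using prob_Inter[of "{a}"] that I_singletons by simp
  have "indep_events (\<lambda>a. {y \<in> I. a \<in> y}) x" if "x \<in> I" for x
    unfolding indep_events_def
  proof (intro conjI allI impI)
    show "(\<lambda>a. {y \<in> I. a \<in> y}) ` x \<subseteq> events"
      by (auto simp: M_def sets_point_measure)
    fix J assume "J \<subseteq> x" "J \<noteq> {}"
    then have J: "J \<in> I" "J \<subseteq> V" using that I_down_closed I_subset by blast+
    have "(\<Prod>a\<in>J. prob {y \<in> I. a \<in> y}) = (\<Prod>a\<in>J. t * f {a})"
      using J by (intro prod.cong) (auto simp: prob_event)
    then show "prob (\<Inter>a\<in>J. {y \<in> I. a \<in> y}) = (\<Prod>a\<in>J. prob {y \<in> I. a \<in> y})"
      using J \<open>J \<noteq> {}\<close> by (simp add: prob_Inter prod_scaled_f)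
  qed
  moreover have "prob (\<Inter>a\<in>x. {y \<in> I. a \<in> y}) = 0" if "x \<in> D" for x
  proof -
    have "x \<noteq> {}" using that D_eq empty_in_I by auto
    \<comment> \<open>A member of \<open>I\<close> above \<open>x\<close> would force
      \<open>x \<in> I\<close>, so this intersection is empty and not merely null.\<close>
    moreover have "{y \<in> I. x \<subseteq> y} = {}" using that D_eq I_down_closed by auto
    ultimately show ?thesis by (metis Inter measure_empty)
  qed
  ultimately show ?thesis
    unfolding realizes_def M_def[symmetric]
    using prob_event prob_space_axioms by (auto simp: M_def sets_point_measure)
qed

lemma probabilistic_configuration_iff:
  "probabilistic_configuration TYPE('a set) V I D f t \<longleftrightarrow>
    t \<ge> 0 \<and> (\<forall>x\<in>I. H I f x t \<ge> 0)"
  unfolding probabilistic_configuration_def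
  by (intro conj_cong iffI ballI) (auto intro: realizes_H_nonneg realizes_point_measure)

section \<open>The interval of admissible parameters\<close>

lemma nonneg_interval:
  assumes "V \<noteq> {}"
  shows "\<exists>t0>0. {t. t \<ge> 0 \<and> (\<forall>x\<in>I. H I f x t \<ge> 0)} = {0..t0} \<and> (\<exists>x\<in>I. H I f x t0 = 0)"
proof -
  define A where "A = {t. t \<ge> 0 \<and> (\<forall>x\<in>I. H I f x t \<ge> 0)}"
  obtain a where a: "a \<in> V" using assms by auto
  \<comment> \<open>The masses above \<open>{a}\<close> add up to \<open>t * f {a}\<close>, which
    cannot exceed the total mass 1.\<close>
  have "t \<le> 1 / f {a}" if "t \<in> A" for t
  proof -
    have "t * f {a} = (\<Sum>y | y \<in> I \<and> {a} \<subseteq> y. H I f y t)"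
      using sum_H[of "{a}" t] a I_singletons by simp
    also have "\<dots> \<le> (\<Sum>y\<in>I. H I f y t)"
      using that finite_I by (intro sum_mono2) (auto simp: A_def)
    finally show ?thesis
      using f_pos[of "{a}"] a I_singletons by (simp add: sum_H_I field_simps)
  qed
  then have bdd: "bdd_above A" by (rule bdd_aboveI)
  have "eventually (\<lambda>t. \<forall>x\<in>I. H I f x t > 0) (at_right 0)"
    using finite_I eventually_H_pos by (simp add: eventually_ball_finite)
  then obtain e where e: "e > 0" "\<And>t. 0 < t \<Longrightarrow> t < e \<Longrightarrow> \<forall>x\<in>I. H I f x t > 0"
    by (auto simp: eventually_at_right_field)
  \<comment> \<open>This point makes \<open>A\<close> nonempty and its supremum positive.\<close>
  have half: "e / 2 \<in> A" using e(1) e(2)[of "e / 2"] by (auto simp: A_def less_imp_le)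
  have "closed A"
  proof -
    have "A = {0..} \<inter> (\<Inter>x\<in>I. {t. 0 \<le> H I f x t})" by (auto simp: A_def)
    then show ?thesis
      by (auto intro!: closed_INT closed_Int closed_Collect_le continuous_on_H continuous_on_const)
  qed
  define t0 where "t0 = Sup A"
  have t0A: "t0 \<in> A"
    unfolding t0_def using half bdd \<open>closed A\<close> by (intro closed_contains_Sup) auto
  have t0_upper: "t \<le> t0" if "t \<in> A" for t
    unfolding t0_def using that bdd by (rule cSup_upper)
  have t0_pos: "t0 > 0" using t0_upper[OF half] e by simp
  have "0 \<in> A"
  proof -
    \<comment> \<open>Thinning from \<open>t0\<close> with \<open>u = 0\<close> covers the endpoint
      that \<open>H_pos_below\<close> excludes.\<close>
    have "H I f x 0 \<ge> 0" if "x \<in> I" for x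
      using H_thinning[OF that, of 0 t0] t0A
      by (auto intro!: mult_nonneg_nonneg sum_nonneg simp: A_def)
    then show ?thesis by (simp add: A_def)
  qed
  have "A = {0..t0}"
  proof (intro equalityI subsetI)
    fix t assume "t \<in> {0..t0}"
    then consider "t = 0" | "t = t0" | "0 < t" "t < t0" by fastforce
    then show "t \<in> A"
    proof cases
      case 3
      then show ?thesis using H_pos_below[of t0 t] t0A by (auto simp: A_def less_imp_le)
    qed (use \<open>0 \<in> A\<close> t0A in auto)
  qed (use t0_upper in \<open>auto simp: A_def\<close>)
  \<comment> \<open>If all masses were positive at \<open>t0\<close>, then, being finitely many
    continuous functions, they would stay positive slightly to the right, against
    maximality.\<close>
  moreover have "\<exists>x\<in>I. H I f x t0 = 0"
  proof (rule ccontr)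
    assume "\<not> ?thesis"
    then have pos: "\<forall>x\<in>I. H I f x t0 > 0" using t0A by (force simp: A_def)
    have "eventually (\<lambda>t. H I f x t > 0) (at_right t0)" if "x \<in> I" for x
    proof -
      have "isCont (H I f x) t0"
        using continuous_on_H[of UNIV] by (simp add: continuous_on_eq_continuous_at)
      then have "(H I f x \<longlongrightarrow> H I f x t0) (at_right t0)"
        by (simp add: isCont_def filterlim_at_split)
      then show ?thesis using pos that by (auto intro: order_tendstoD)
    qed
    then have "eventually (\<lambda>t. \<forall>x\<in>I. H I f x t > 0) (at_right t0)"
      using finite_I by (simp add: eventually_ball_finite)
    then obtain b where b: "b > t0" "\<And>t. t0 < t \<Longrightarrow> t < b \<Longrightarrow> \<forall>x\<in>I. H I f x t > 0"
      by (auto simp: eventually_at_right_field)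
    obtain t where t: "t0 < t" "t < b" using dense[OF b(1)] by auto
    then have "t \<in> A" using b(2)[OF t] t0_pos by (auto simp: A_def less_imp_le)
    then show False using t0_upper t by force
  qed
  ultimately show ?thesis using t0_pos unfolding A_def by blast
qed

end

theorem theorem2:
  fixes V :: "'a set" and I D :: "'a set set" and f :: "'a set \<Rightarrow> real"
  assumes "weighted_configuration V I D f" and "V \<noteq> {}"
  shows "\<exists>t0::real.
    t0 \<in> {t. t > 0 \<and> (\<exists>x\<in>I. H I f x t = 0)} \<and>
    (\<forall>t \<in> {t. t > 0 \<and> (\<exists>x\<in>I. H I f x t = 0)}. t0 \<le> t) \<and>
    {t. probabilistic_configuration TYPE('a set) V I D f t} = {0..t0} \<and>
    {t. probabilistic_configuration TYPE('w) V I D f t} \<subseteq> {0..t0} \<and>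
    (\<forall>t\<ge>0. \<forall>(M :: 'w measure) \<psi>. realizes V I D f t M \<psi> \<longrightarrow> rest V M \<psi> = H I f {} t) \<and>
    strict_antimono_on {0..t0} (H I f {}) \<and>
    is_arg_min (H I f {}) (probabilistic_configuration TYPE('a set) V I D f) t0"
proof -
  interpret weighted_configuration V I D f by fact
  obtain t0 where t0: "t0 > 0" "\<exists>x\<in>I. H I f x t0 = 0"
    and A: "{t. t \<ge> 0 \<and> (\<forall>x\<in>I. H I f x t \<ge> 0)} = {0..t0}"
    using nonneg_interval[OF assms(2)] by blast
  have nonneg: "\<forall>x\<in>I. H I f x t \<ge> 0" if "t \<in> {0..t0}" for t
    using that A by blast
  have prob: "probabilistic_configuration TYPE('a set) V I D f t \<longleftrightarrow> t \<in> {0..t0}" for t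
    using A by (auto simp: probabilistic_configuration_iff)
  \<comment> \<open>A positive root below \<open>t0\<close> would contradict the strict positivity
    obtained by thinning from \<open>t0\<close>.\<close>
  have least: "t0 \<le> t" if "t > 0" "x \<in> I" "H I f x t = 0" for t x
    using H_pos_below[of t0 t x] nonneg[of t0] t0 that by force
  \<comment> \<open>Necessity holds over any type of sample points. Only an inclusion is claimed,
    since a small type \<open>'w\<close> may not carry the required events.\<close>
  have sub: "{t. probabilistic_configuration TYPE('w) V I D f t} \<subseteq> {0..t0}"
    unfolding A[symmetric] using realizes_H_nonneg
    by (auto simp: probabilistic_configuration_def)
  have dec: "strict_antimono_on {0..t0} (H I f {})"
    by (rule monotone_onI) (use H_empty_less nonneg assms(2) in auto)
  have "\<not> H I f {} t < H I f {} t0" if "t \<in> {0..t0}" for t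
    using monotone_onD[OF dec that, of t0] that t0 by (cases "t = t0") auto
  then have "is_arg_min (H I f {}) (probabilistic_configuration TYPE('a set) V I D f) t0"
    using t0 by (auto simp: is_arg_min_def prob)
  with t0 least sub dec prob realizes_rest show ?thesis
    by (intro exI[of _ t0]) auto
qed

end
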